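(* Let $n,d,m$ be integers such that $1 \le d \le n$ and $0\le m \le nd - \binom{d}{2}$. Then there exists a Zariski-closed proper subset $E \subseteq \mathrm{Gr}(m,\mathcal{S}^n)$ such that for every $m$-dimensional linear subspace $L\subseteq \mathcal{S}^n$ with $L \notin E$ there exists a Zariski-closed proper subset $F_L \subset \mathcal{S}^n_0(d)$ such that if $S \in \mathcal{S}^n_0(d) \setminus F_L$ then $\Omega S \neq 0$ for all $\Omega \in L\setminus\{0\}$.
   Context: $\mathcal{S}^n$ is the vector space of real symmetric $n\times n$ matrices and $\mathcal{S}^n_0(d)$ is the set of matrices in $\mathcal{S}^n$ of rank exactly $d$, with the Zariski topology induced from $\mathcal{S}^n$. $\mathrm{Gr}(m,\mathcal{S}^n)$ is the Grassmannian of $m$-dimensional linear subspaces of $\mathcal{S}^n$, viewed as a real projective variety via Plücker coordinates. *)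

theory Defs
  imports "HOL-Analysis.Analysis" "HOL-Library.Poly_Mapping" "Jordan_Normal_Form.Determinant"
begin

no_notation Matrix.vec_index (infixl "$" 100)
hide_const (open) Matrix.mat Matrix.vec Matrix.transpose_mat Determinant.det

text \<open>Matrices are indexed by a finite linearly ordered type \<open>'n\<close>, so \<open>n = CARD('n)\<close>.\<close>

definition sym_matrices :: "(real^'n^'n) set" where
  "sym_matrices = {A. transpose A = A}"

definition sym_rank :: "nat \<Rightarrow> (real^'n^'n) set" where
  "sym_rank d = {A \<in> sym_matrices. rank A = d}"

text \<open>On a finite-dimensional space, \<^const>\<open>real_polynomial_function\<close> holds of exactly the
  functions that are polynomials in the coordinates, here the matrix entries; their restrictions
  to the symmetric matrices are the polynomial functions on that space.\<close>

definition zariski_closed_sym :: "(real^'n^'n) set \<Rightarrow> bool" where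
  "zariski_closed_sym C \<longleftrightarrow>
     (\<exists>P. (\<forall>f\<in>P. real_polynomial_function f) \<and> C = {X \<in> sym_matrices. \<forall>f\<in>P. f X = 0})"

definition zariski_closed_sym_rank :: "nat \<Rightarrow> (real^'n^'n) set \<Rightarrow> bool" where
  "zariski_closed_sym_rank d F \<longleftrightarrow> (\<exists>C. zariski_closed_sym C \<and> F = sym_rank d \<inter> C)"

text \<open>Multivariate polynomials: an exponent vector \<open>'i \<Rightarrow>\<^sub>0 nat\<close> is a monomial, and a polynomial
  maps finitely many monomials to nonzero coefficients.\<close>

definition poly_value :: "(('i \<Rightarrow>\<^sub>0 nat) \<Rightarrow>\<^sub>0 real) \<Rightarrow> ('i \<Rightarrow> real) \<Rightarrow> real" where
  "poly_value p x =
     (\<Sum>\<alpha>\<in>Poly_Mapping.keys p. Poly_Mapping.lookup p \<alpha> *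
        (\<Prod>i\<in>Poly_Mapping.keys \<alpha>. x i ^ Poly_Mapping.lookup \<alpha> i))"

definition homogeneous_poly_in :: "'i set \<Rightarrow> (('i \<Rightarrow>\<^sub>0 nat) \<Rightarrow>\<^sub>0 real) \<Rightarrow> bool" where
  "homogeneous_poly_in J p \<longleftrightarrow>
     (\<exists>e. \<forall>\<alpha>\<in>Poly_Mapping.keys p. Poly_Mapping.keys \<alpha> \<subseteq> J \<and>
        (\<Sum>i\<in>Poly_Mapping.keys \<alpha>. Poly_Mapping.lookup \<alpha> i) = e)"

definition sym_grassmannian :: "nat \<Rightarrow> (real^'n^'n) set set" where
  "sym_grassmannian m = {L. subspace L \<and> L \<subseteq> sym_matrices \<and> dim L = m}"

text \<open>The entries at positions \<open>(i, j)\<close> with \<open>i \<le> j\<close> are linear coordinates on the symmetric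
  matrices. The Plucker coordinates are indexed by the \<open>m\<close>-element sets of such positions, each
  listed in increasing lexicographic order.\<close>

definition plucker_indices :: "nat \<Rightarrow> ('n::linorder \<times> 'n) list set" where
  "plucker_indices m =
     {I. length I = m \<and> (\<forall>(i, j)\<in>set I. i \<le> j) \<and>
         sorted_wrt (\<lambda>(i, j) (k, l). i < k \<or> i = k \<and> j < l) I}"

definition plucker_coord :: "nat \<Rightarrow> (real^'n^'n) list \<Rightarrow> ('n \<times> 'n) list \<Rightarrow> real" where
  "plucker_coord m B I =
     Determinant.det (Matrix.mat m m (\<lambda>(k, l). B ! k $ fst (I ! l) $ snd (I ! l)))"

definition ordered_basis_of :: "(real^'n^'n) set \<Rightarrow> (real^'n^'n) list \<Rightarrow> bool" where
  "ordered_basis_of L B \<longleftrightarrow> distinct B \<and> independent (set B) \<and> span (set B) = L"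

text \<open>Another basis of \<open>L\<close> multiplies all Plucker coordinates by one nonzero scalar, so whether a
  homogeneous polynomial vanishes at \<open>L\<close> does not depend on the basis; quantifying over all
  bases avoids choosing one.\<close>

definition zariski_closed_grassmannian ::
    "nat \<Rightarrow> (real^'n::{finite,linorder}^'n::{finite,linorder}) set set \<Rightarrow> bool" where
  "zariski_closed_grassmannian m E \<longleftrightarrow>
     (\<exists>P. (\<forall>p\<in>P. homogeneous_poly_in (plucker_indices m) p) \<and>
          E = {L \<in> sym_grassmannian m. \<forall>p\<in>P. \<forall>B. ordered_basis_of L B \<longrightarrow>
                 poly_value p (plucker_coord m B) = 0})"

end

theory Submission
  imports Defs
begin

text \<open>
  Only one rank-\<open>d\<close> matrix has to be inspected: the diagonal projection \<open>S\<^sub>T\<close> onto a set \<open>T\<close> of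
  \<open>d\<close> coordinates. Multiplying a symmetric \<open>\<Omega>\<close> by \<open>S\<^sub>T\<close> keeps the columns in \<open>T\<close> and kills the
  others, so \<open>\<Omega> S\<^sub>T\<close> shows exactly the entries of \<open>\<Omega>\<close> whose position meets \<open>T\<close>. Up to symmetry
  there are \<open>n d - (d choose 2)\<close> such positions (\<open>card_positions_meeting\<close>), which is where the
  bound on \<open>m\<close> comes from: it allows choosing a list \<open>I\<close> of \<open>m\<close> of them.

  Let \<open>E\<close> be the zero set of the single Plucker coordinate with index \<open>I\<close>. It is proper, because the
  coordinate is \<open>1\<close> on the span of the symmetric matrix units at the positions in \<open>I\<close>. For \<open>L\<close>
  outside \<open>E\<close> with basis \<open>B\<close>, let \<open>f S\<close> be the determinant of the \<open>m\<close> by \<open>m\<close> matrix of the entries of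
  \<open>B ! k ** S\<close> at the positions in \<open>I\<close>, each read in the order that puts its column in \<open>T\<close>. This is a
  polynomial in \<open>S\<close>, and \<open>f S \<noteq> 0\<close> forces \<open>\<Omega> \<mapsto> \<Omega> S\<close> to be injective on \<open>L\<close>
  (\<open>nonzero_evaluation_det_imp_zero\<close>). Its value at \<open>S\<^sub>T\<close> is the Plucker coordinate of \<open>L\<close> itself, so
  the zero set \<open>F\<close> of \<open>f\<close> misses \<open>S\<^sub>T\<close>.
\<close>

section \<open>Positions meeting a set of indices\<close>

definition positions_meeting :: "'n::linorder set \<Rightarrow> ('n \<times> 'n) set" where
  "positions_meeting T = {(i, j). i \<le> j \<and> (i \<in> T \<or> j \<in> T)}"

text \<open>Adding an index \<open>x\<close> to \<open>T\<close> adds the positions formed by \<open>x\<close> and the indices outside \<open>T\<close>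
  (\<open>x\<close> among them), so the counts are \<open>n + (n - 1) + \<dots> + (n - d + 1)\<close>.\<close>

lemma card_positions_meeting:
  fixes T :: "'n::{finite,linorder} set"
  shows "int (card (positions_meeting T)) =
    int CARD('n) * int (card T) - int (card T choose 2)"
proof -
  have "finite T" by simp
  then show ?thesis
  proof (induction T rule: finite_induct)
    case empty
    then show ?case by (simp add: positions_meeting_def)
  next
    case (insert x T)
    define N where "N = (\<lambda>j. (min x j, max x j)) ` (- T)"
    have split: "positions_meeting (insert x T) = positions_meeting T \<union> N"
    proof (intro Set.set_eqI iffI)
      fix p assume p: "p \<in> positions_meeting (insert x T)"
      obtain i j where ij: "p = (i, j)" by (cases p)
      show "p \<in> positions_meeting T \<union> N"
      proof (cases "i \<in> T \<or> j \<in> T")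
        case True
        then show ?thesis using p ij by (auto simp: positions_meeting_def)
      next
        case False
        then have "i \<le> j" "i = x \<or> j = x" using p ij by (auto simp: positions_meeting_def)
        then have "p = (min x j, max x j) \<or> p = (min x i, max x i)"
          using ij by (auto simp: min_def max_def)
        then show ?thesis using False unfolding N_def by blast
      qed
    next
      fix p assume "p \<in> positions_meeting T \<union> N"
      then show "p \<in> positions_meeting (insert x T)"
        unfolding positions_meeting_def N_def by (auto simp: min_def max_def)
    qed
    have disj: "positions_meeting T \<inter> N = {}"
      using insert.hyps unfolding positions_meeting_def N_def
    by (auto simp: min_def max_def split: if_splits)
    have "inj_on (\<lambda>j. (min x j, max x j)) (- T)"
      by (auto simp: inj_on_def min_def max_def split: if_splits)
    then have "card N = card (- T)" unfolding N_def by (rule card_image)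
    also have "\<dots> = CARD('n) - card T" by (simp add: Compl_eq_Diff_UNIV card_Diff_subset)
    finally have N: "int (card N) = int CARD('n) - int (card T)"
      by (simp add: of_nat_diff card_mono)
    have "int (card (positions_meeting (insert x T))) =
        int (card (positions_meeting T)) + int (card N)"
      unfolding split using disj by (subst card_Un_disjoint) simp_all
    then show ?case
      using insert N by (simp add: algebra_simps numeral_2_eq_2)
  qed
qed

lemma finite_imp_sorted_lex_list:
  fixes D :: "('n::linorder \<times> 'n) set"
  assumes "finite D"
  shows "\<exists>xs. set xs = D \<and> sorted_wrt (\<lambda>(i, j) (k, l). i < k \<or> i = k \<and> j < l) xs"
proof -
  interpret lex: linorder
    "\<lambda>(i :: 'n, j :: 'n) (k, l). i < k \<or> i = k \<and> j \<le> l"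
    "\<lambda>(i :: 'n, j :: 'n) (k, l). i < k \<or> i = k \<and> j < l"
    by unfold_locales (auto split: prod.splits)
  show ?thesis
    using assms lex.set_sorted_list_of_set lex.strict_sorted_list_of_set by blast
qed

lemma plucker_index_within:
  fixes D :: "('n::linorder \<times> 'n) set"
  assumes "finite D" and "m \<le> card D" and "\<And>i j. (i, j) \<in> D \<Longrightarrow> i \<le> j"
  shows "\<exists>I \<in> plucker_indices m. set I \<subseteq> D"
proof -
  obtain xs where xs: "set xs = D"
      "sorted_wrt (\<lambda>(i, j) (k, l). i < k \<or> i = k \<and> j < l) xs"
    using finite_imp_sorted_lex_list[OF assms(1)] by blast
  have "m \<le> length xs"
    using assms(2) card_length[of xs] xs(1) by simp
  moreover have sub: "set (take m xs) \<subseteq> D"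
    using xs(1) set_take_subset by fast
  ultimately have "take m xs \<in> plucker_indices m"
    using assms(3) xs(2) unfolding plucker_indices_def by (auto intro: sorted_wrt_take)
  with sub show ?thesis by blast
qed

lemma plucker_index_distinct: "I \<in> plucker_indices m \<Longrightarrow> distinct I"
proof -
  have "distinct xs" if "sorted_wrt (\<lambda>(i, j) (k, l). i < k \<or> i = k \<and> j < l) xs"
    for xs :: "('a::linorder \<times> 'a) list"
    using that by (induction xs) auto
  then show "I \<in> plucker_indices m \<Longrightarrow> distinct I" by (simp add: plucker_indices_def)
qed

section \<open>Evaluation determinants\<close>

text \<open>The coefficient vector of a combination of the \<open>v k\<close> killed by all functionals \<open>\<phi> l\<close> lies in
  the left kernel of the matrix \<open>\<phi> l (v k)\<close>. This serves both for the independence of matrices with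
  a nonzero Plucker coordinate and for the injectivity of multiplication by \<open>S\<close>.\<close>

lemma nonzero_evaluation_det_imp_zero:
  fixes \<phi> :: "nat \<Rightarrow> 'a::real_vector \<Rightarrow> real"
  assumes det: "Determinant.det (Matrix.mat m m (\<lambda>(k, l). \<phi> l (v k))) \<noteq> 0"
    and lin: "\<And>l. l < m \<Longrightarrow> linear (\<phi> l)"
    and zero: "\<And>l. l < m \<Longrightarrow> \<phi> l (\<Sum>k<m. c k *\<^sub>R v k) = 0"
    and "k < m"
  shows "c k = 0"
proof -
  define M where "M = Matrix.mat m m (\<lambda>(k, l). \<phi> l (v k))"
  define w where "w = Matrix.vec m c"
  have M: "M \<in> carrier_mat m m" unfolding M_def by simp
  have w: "w \<in> carrier_vec m" unfolding w_def by simp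
  have "M\<^sup>T *\<^sub>v w = 0\<^sub>v m"
  proof (rule eq_vecI)
    fix l assume "l < dim_vec (0\<^sub>v m :: real Matrix.vec)"
    then have l: "l < m" by simp
    have "vec_index (M\<^sup>T *\<^sub>v w) l = (\<Sum>k<m. \<phi> l (v k) * c k)"
      using l by (auto simp: M_def w_def scalar_prod_def lessThan_atLeast0 intro!: sum.cong)
    also have "\<dots> = \<phi> l (\<Sum>k<m. c k *\<^sub>R v k)"
      by (simp add: linear_sum[OF lin[OF l]] linear_cmul[OF lin[OF l]] mult.commute)
    finally show "vec_index (M\<^sup>T *\<^sub>v w) l = vec_index (0\<^sub>v m) l"
      using zero[OF l] l by simp
  qed (simp add: M_def)
  moreover have "Determinant.det M\<^sup>T \<noteq> 0"
    using det det_transpose[OF M] by (simp add: M_def)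
  ultimately have "w = 0\<^sub>v m"
    using det_0_iff_vec_prod_zero_field[of "M\<^sup>T" m] M w by auto
  then have "vec_index w k = vec_index (0\<^sub>v m) k" by simp
  then show ?thesis using \<open>k < m\<close> unfolding w_def by simp
qed

lemma linear_matrix_entry: "linear (\<lambda>\<Omega> :: real^'n^'m. \<Omega> $ a $ b)"
  by (rule linearI) simp_all

lemma linear_matrix_mult_entry: "linear (\<lambda>\<Omega> :: real^'n^'m. (\<Omega> ** S) $ a $ b)"
  by (rule linearI) (simp_all add: matrix_matrix_mult_def sum.distrib algebra_simps sum_distrib_left)

lemma ordered_basis_of_if_plucker_coord_nonzero:
  assumes len: "length B = m" and nz: "plucker_coord m B I \<noteq> 0"
  shows "ordered_basis_of (span (set B)) B"
proof -
  have zero: "c k = 0" if "(\<Sum>k<m. c k *\<^sub>R (B ! k)) = 0" "k < m" for c k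
    by (rule nonzero_evaluation_det_imp_zero
        [where v = "\<lambda>k. B ! k" and \<phi> = "\<lambda>l \<Omega>. \<Omega> $ fst (I ! l) $ snd (I ! l)"])
      (use nz that in \<open>simp_all add: plucker_coord_def linear_matrix_entry\<close>)
  have dist: "distinct B"
    unfolding distinct_conv_nth
  proof (intro allI impI notI)
    \<comment> \<open>Two equal entries would give the nontrivial relation \<open>B ! i - B ! j = 0\<close>.\<close>
    fix i j assume ij: "i < length B" "j < length B" "i \<noteq> j" "B ! i = B ! j"
    define c :: "nat \<Rightarrow> real" where "c k = (if k = i then 1 else if k = j then -1 else 0)" for k
    have "(\<Sum>k<m. c k *\<^sub>R (B ! k)) = (\<Sum>k\<in>{i, j}. c k *\<^sub>R (B ! k))"
      by (rule sum.mono_neutral_right) (use ij len in \<open>auto simp: c_def\<close>)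
    also have "\<dots> = 0" using ij by (simp add: c_def)
    finally have "c i = 0" using zero ij len by blast
    then show False by (simp add: c_def)
  qed
  have bij: "bij_betw ((!) B) {..<m} (set B)"
    using bij_betw_nth[OF dist] len by simp
  have "independent (set B)"
  proof (rule independent_if_scalars_zero)
    fix g x assume "(\<Sum>x\<in>set B. g x *\<^sub>R x) = 0" and "x \<in> set B"
    moreover have "(\<Sum>x\<in>set B. g x *\<^sub>R x) = (\<Sum>k<m. g (B ! k) *\<^sub>R (B ! k))"
      using sum.reindex_bij_betw[OF bij, of "\<lambda>x. g x *\<^sub>R x"] by simp
    ultimately show "g x = 0"
      using zero[of "\<lambda>k. g (B ! k)"] len by (metis in_set_conv_nth)
  qed simp
  with dist show ?thesis unfolding ordered_basis_of_def by simp
qed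

lemma real_polynomial_function_evaluation_det:
  assumes "\<And>k l. real_polynomial_function (g k l)"
  shows "real_polynomial_function (\<lambda>x. Determinant.det (Matrix.mat m m (\<lambda>(k, l). g k l x)))"
proof -
  have fin: "finite {p. p permutes {0..<m}}" by (simp add: finite_permutations)
  have "real_polynomial_function
      (\<lambda>x. \<Sum>p | p permutes {0..<m}. signof p * (\<Prod>i = 0..<m. g i (p i) x))"
    by (intro real_polynomial_function_sum real_polynomial_function_prod fin
        real_polynomial_function.intros assms) auto
  moreover have "Determinant.det (Matrix.mat m m (\<lambda>(k, l). g k l x)) =
      (\<Sum>p | p permutes {0..<m}. signof p * (\<Prod>i = 0..<m. g i (p i) x))" for x
    unfolding Determinant.det_def
    by (auto intro!: sum.cong prod.cong arg_cong2[where f = "(*)"]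
        simp: permutes_in_image)
  ultimately show ?thesis by simp
qed

section \<open>The projection onto a set of coordinates\<close>

definition coordinate_projection :: "'n set \<Rightarrow> real^'n^'n" where
  "coordinate_projection T = (\<chi> i j. if i = j \<and> i \<in> T then 1 else 0)"

lemma coordinate_projection_in_sym_rank: "coordinate_projection T \<in> sym_rank (card T)"
proof -
  have vec: "coordinate_projection T *v x = (\<chi> i. if i \<in> T then x $ i else 0)" for x
  proof -
    have "(\<Sum>j\<in>UNIV. (if i = j \<and> i \<in> T then 1 else 0) * x $ j) =
        (\<Sum>j\<in>UNIV. if i = j then (if i \<in> T then x $ i else 0) else 0)" for i
      by (rule sum.cong) auto
    then show ?thesis
      by (simp add: coordinate_projection_def matrix_vector_mult_def)
  qed
  have "range ((*v) (coordinate_projection T)) = {x. \<forall>i. i \<notin> T \<longrightarrow> x $ i = 0}"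
  proof (intro Set.set_eqI iffI)
    fix x :: "real^'a" assume "x \<in> {x. \<forall>i. i \<notin> T \<longrightarrow> x $ i = 0}"
    then have "x = coordinate_projection T *v x" by (auto simp: vec Finite_Cartesian_Product.vec_eq_iff)
    then show "x \<in> range ((*v) (coordinate_projection T))" by blast
  qed (auto simp: vec)
  then have "rank (coordinate_projection T) = card T"
    by (simp add: rank_dim_range dim_substandard_cart flip: dim_vec_eq)
  then show ?thesis
    by (auto simp: sym_rank_def sym_matrices_def coordinate_projection_def transpose_def Finite_Cartesian_Product.vec_eq_iff)
qed

lemma matrix_mult_coordinate_projection:
  "(\<Omega> ** coordinate_projection T) $ a $ b = (if b \<in> T then \<Omega> $ a $ b else 0)"
proof -
  have "(\<Omega> ** coordinate_projection T) $ a $ b =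
      (\<Sum>k\<in>UNIV. if k = b then (if b \<in> T then \<Omega> $ a $ b else 0) else 0)"
    unfolding matrix_matrix_mult_def coordinate_projection_def vec_lambda_beta
    by (rule sum.cong) auto
  then show ?thesis by simp
qed

text \<open>Symmetric matrices do not see which of two mirror positions is read, but the product with
  the projection keeps only the one whose column lies in \<open>T\<close>.\<close>

definition column_into :: "'n set \<Rightarrow> 'n \<times> 'n \<Rightarrow> 'n \<times> 'n" where
  "column_into T p = (if snd p \<in> T then p else prod.swap p)"

lemma column_into_projection_entry:
  assumes "\<Omega> \<in> sym_matrices" and "p \<in> positions_meeting T"
  shows "(\<Omega> ** coordinate_projection T) $ fst (column_into T p) $ snd (column_into T p) =
    \<Omega> $ fst p $ snd p"
proof -
  have "\<Omega> $ snd p $ fst p = \<Omega> $ fst p $ snd p"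
    using assms(1) unfolding sym_matrices_def transpose_def by (auto simp: Finite_Cartesian_Product.vec_eq_iff)
  then show ?thesis
    using assms(2)
    by (auto simp: column_into_def matrix_mult_coordinate_projection positions_meeting_def)
qed

section \<open>Plucker coordinates as polynomials\<close>

lemma homogeneous_poly_in_variable:
  "I \<in> J \<Longrightarrow> homogeneous_poly_in J (Poly_Mapping.single (Poly_Mapping.single I 1) 1)"
  by (auto simp: homogeneous_poly_in_def)

lemma poly_value_variable:
  "poly_value (Poly_Mapping.single (Poly_Mapping.single I 1) 1) x = x I"
  by (simp add: poly_value_def)

definition sym_matrix_unit :: "'n \<times> 'n \<Rightarrow> real^'n^'n" where
  "sym_matrix_unit p = (\<chi> a b. if (a, b) = p \<or> (b, a) = p then 1 else 0)"

lemma exists_nonzero_plucker_coord: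
  fixes I :: "('n::{finite,linorder} \<times> 'n) list"
  assumes I: "I \<in> plucker_indices m"
  shows "\<exists>L B. L \<in> sym_grassmannian m \<and> ordered_basis_of L B \<and> plucker_coord m B I \<noteq> 0"
proof -
  define B where "B = map sym_matrix_unit I"
  have len: "length I = m" and le: "\<And>p. p \<in> set I \<Longrightarrow> fst p \<le> snd p"
    using I unfolding plucker_indices_def by auto
  \<comment> \<open>A position and its mirror image both being listed would force them to be equal.\<close>
  have entry: "B ! k $ fst (I ! l) $ snd (I ! l) = (if k = l then 1 else 0)"
    if "k < m" "l < m" for k l
  proof -
    have "fst (I ! k) \<le> snd (I ! k)" "fst (I ! l) \<le> snd (I ! l)" using le len that by simp_all
    then have "(snd (I ! l), fst (I ! l)) = I ! k \<Longrightarrow> I ! l = I ! k"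
      by (metis antisym fst_conv snd_conv prod.collapse)
    moreover have "I ! l = I ! k \<longleftrightarrow> k = l"
      using plucker_index_distinct[OF I] len that by (auto simp: nth_eq_iff_index_eq)
    ultimately show ?thesis using len that by (auto simp: B_def sym_matrix_unit_def)
  qed
  have "Matrix.mat m m (\<lambda>(k, l). B ! k $ fst (I ! l) $ snd (I ! l)) = 1\<^sub>m m"
    by (rule eq_matI) (simp_all add: entry)
  then have nz: "plucker_coord m B I \<noteq> 0" unfolding plucker_coord_def by simp
  have lenB: "length B = m" using len by (simp add: B_def)
  have basis: "ordered_basis_of (span (set B)) B"
    by (rule ordered_basis_of_if_plucker_coord_nonzero[OF lenB nz])
  have sub: "subspace (sym_matrices :: (real^'n::{finite,linorder}^'n::{finite,linorder}) set)"
    by (auto simp: subspace_def sym_matrices_def transpose_def Finite_Cartesian_Product.vec_eq_iff)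
  have "set B \<subseteq> sym_matrices"
    by (auto simp: B_def sym_matrices_def sym_matrix_unit_def transpose_def Finite_Cartesian_Product.vec_eq_iff)
  then have "span (set B) \<subseteq> sym_matrices" using sub by (simp add: span_minimal)
  moreover have "dim (span (set B)) = m"
    using basis lenB unfolding ordered_basis_of_def
    by (simp add: dim_eq_card_independent distinct_card)
  ultimately have "span (set B) \<in> sym_grassmannian m"
    by (simp add: sym_grassmannian_def)
  with basis nz show ?thesis by blast
qed

section \<open>Generic subspaces against generic matrices of given rank\<close>

text \<open>The determinant of the entries of \<open>B ! k ** S\<close> at the positions \<open>I\<close>, mirrored where
  necessary to put the column in \<open>T\<close>, specialises at the projection onto \<open>T\<close> to the Plucker
  coordinate \<open>I\<close> of \<open>L\<close>.\<close>

lemma generic_sym_rank_annihilates_trivially: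
  fixes L :: "(real^'n::{finite,linorder}^'n::{finite,linorder}) set"
  assumes L: "L \<in> sym_grassmannian m" and B: "ordered_basis_of L B"
    and I: "I \<in> plucker_indices m" and IT: "set I \<subseteq> positions_meeting T"
    and nz: "plucker_coord m B I \<noteq> 0"
  shows "\<exists>F. zariski_closed_sym_rank (card T) F \<and> F \<subset> sym_rank (card T) \<and>
    (\<forall>S \<in> sym_rank (card T) - F. \<forall>\<Omega> \<in> L - {0}. \<Omega> ** S \<noteq> 0)"
proof -
  define a where "a l = fst (column_into T (I ! l))" for l
  define b where "b l = snd (column_into T (I ! l))" for l
  define f where "f S = Determinant.det (Matrix.mat m m (\<lambda>(k, l). (B ! k ** S) $ a l $ b l))"
    for S
  define F where "F = sym_rank (card T) \<inter> {X \<in> sym_matrices. \<forall>g\<in>{f}. g X = 0}"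
  have dist: "distinct B" and indep: "independent (set B)" and span: "span (set B) = L"
    using B unfolding ordered_basis_of_def by auto
  have "dim L = card (set B)" using indep span dim_span_eq_card_independent by metis
  then have lenB: "length B = m"
    using L dist by (simp add: sym_grassmannian_def distinct_card)
  have Bsym: "B ! k \<in> sym_matrices" if "k < m" for k
    using that lenB span L span_superset[of "set B"] nth_mem[of k B]
    unfolding sym_grassmannian_def by blast
  have "linear (\<lambda>S. (B ! k ** S) $ a l $ b l)" for k l
    by (rule linearI)
      (simp_all add: matrix_matrix_mult_def sum.distrib algebra_simps sum_distrib_left)
  then have "real_polynomial_function f"
    unfolding f_def
    by (intro real_polynomial_function_evaluation_det real_polynomial_function.intros(1))
      (simp add: linear_conv_bounded_linear)
  then have "zariski_closed_sym {X \<in> sym_matrices. \<forall>g\<in>{f}. g X = 0}"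
    unfolding zariski_closed_sym_def by (intro exI[of _ "{f}"]) simp
  then have closed: "zariski_closed_sym_rank (card T) F"
    unfolding F_def zariski_closed_sym_rank_def by (intro exI conjI) (assumption, rule refl)
  have "I ! l \<in> positions_meeting T" if "l < m" for l
    using I IT that nth_mem unfolding plucker_indices_def by blast
  then have "f (coordinate_projection T) = plucker_coord m B I"
    unfolding f_def plucker_coord_def a_def b_def
    by (intro arg_cong[where f = Determinant.det] eq_matI)
      (simp_all add: column_into_projection_entry Bsym)
  then have "coordinate_projection T \<in> sym_rank (card T) - F"
    using nz coordinate_projection_in_sym_rank unfolding F_def by auto
  then have proper: "F \<subset> sym_rank (card T)" unfolding F_def by blast
  have inj: "\<Omega> = 0"
    if S: "S \<in> sym_rank (card T) - F" and \<Omega>: "\<Omega> \<in> L" and prod: "\<Omega> ** S = 0" for S \<Omega>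
  proof -
    have fS: "f S \<noteq> 0" using S unfolding F_def sym_rank_def by auto
    obtain u where u: "\<Omega> = (\<Sum>x\<in>set B. u x *\<^sub>R x)"
      using \<Omega> span by (auto simp: span_finite)
    have "bij_betw ((!) B) {..<m} (set B)" using bij_betw_nth[OF dist] lenB by simp
    then have sum: "\<Omega> = (\<Sum>k<m. u (B ! k) *\<^sub>R (B ! k))"
      unfolding u by (subst sum.reindex_bij_betw[symmetric]) auto
    have "u (B ! k) = 0" if "k < m" for k
      by (rule nonzero_evaluation_det_imp_zero[where v = "\<lambda>k. B ! k" and m = m
            and c = "\<lambda>k. u (B ! k)" and \<phi> = "\<lambda>l \<Omega>. (\<Omega> ** S) $ a l $ b l"])
        (use that fS prod in
          \<open>simp_all add: f_def linear_matrix_mult_entry flip: sum\<close>)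
    then show ?thesis unfolding sum by simp
  qed
  show ?thesis using closed proper inj by blast
qed

theorem proposition3p22:
  fixes d m :: nat
  assumes "1 \<le> d" and "d \<le> CARD('n::{finite,linorder})"
    and "int m \<le> int CARD('n) * int d - int (d choose 2)"
  shows "\<exists>E :: (real^'n::{finite,linorder}^'n::{finite,linorder}) set set.
    zariski_closed_grassmannian m E \<and> E \<subset> sym_grassmannian m \<and>
    (\<forall>L \<in> sym_grassmannian m. L \<notin> E \<longrightarrow>
       (\<exists>F. zariski_closed_sym_rank d F \<and> F \<subset> sym_rank d \<and>
          (\<forall>S \<in> sym_rank d - F. \<forall>\<Omega> \<in> L - {0}. \<Omega> ** S \<noteq> 0)))"
proof -
  obtain T :: "'n set" where T: "card T = d"
    using assms(2) by (metis obtain_subset_with_card_n)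
  have "m \<le> card (positions_meeting T)"
    using assms(3) card_positions_meeting[of T] T by simp
  then have "\<exists>I \<in> plucker_indices m. set I \<subseteq> positions_meeting T"
    by (intro plucker_index_within) (auto simp: positions_meeting_def)
  then obtain I where I: "I \<in> plucker_indices m" and IT: "set I \<subseteq> positions_meeting T"
    by blast
  define p :: "(('n \<times> 'n) list \<Rightarrow>\<^sub>0 nat) \<Rightarrow>\<^sub>0 real"
    where "p = Poly_Mapping.single (Poly_Mapping.single I 1) 1"
  define E :: "(real^'n::{finite,linorder}^'n::{finite,linorder}) set set" where
    "E = {L \<in> sym_grassmannian m. \<forall>q\<in>{p}. \<forall>B. ordered_basis_of L B \<longrightarrow>
      poly_value q (plucker_coord m B) = 0}"
  have val: "poly_value p (plucker_coord m B) = plucker_coord m B I"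
    for B :: "(real^'n::{finite,linorder}^'n::{finite,linorder}) list"
    unfolding p_def by (rule poly_value_variable)
  have "homogeneous_poly_in (plucker_indices m) p"
    unfolding p_def using I by (rule homogeneous_poly_in_variable)
  then have closed: "zariski_closed_grassmannian m E"
    unfolding zariski_closed_grassmannian_def E_def by (intro exI[of _ "{p}"]) simp
  have proper: "E \<subset> sym_grassmannian m"
    using exists_nonzero_plucker_coord[OF I] val unfolding E_def by auto
  have "\<exists>F. zariski_closed_sym_rank d F \<and> F \<subset> sym_rank d \<and>
      (\<forall>S \<in> sym_rank d - F. \<forall>\<Omega> \<in> L - {0}. \<Omega> ** S \<noteq> 0)"
    if L: "L \<in> sym_grassmannian m" and LE: "L \<notin> E" for L
  proof -
    obtain B where "ordered_basis_of L B" "plucker_coord m B I \<noteq> 0"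
      using L LE unfolding E_def by (auto simp: val)
    then show ?thesis using generic_sym_rank_annihilates_trivially[OF L _ I IT] T by simp
  qed
  with closed proper show ?thesis by blast
qed

end
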